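(* Let $A \in \mathbb{R}^{n \times n}$ and $p \in (1,\infty)$. Then $A$ is Hurwitz if and only if there exist $r,s \in \mathbb{N}$ and full column rank matrices $R \in \mathbb{R}^{r \times n}$ and $S \in \mathbb{R}^{s \times n}$ such that $$\langle \nabla V_{R,p}(x), Ax\rangle + V_{S,p}(x) \leq 0 \quad \text{for all } x \in \mathbb{R}^n.$$
   Context: For a full column rank matrix $M \in \mathbb{R}^{m\times n}$ and $p\in(1,\infty)$, define $V_{M,p}(x) := \frac{1}{p}\|Mx\|_p^p = \frac1p\sum_{i=1}^m |M_{i:}x|^p$ for $x\in\mathbb{R}^n$, where $M_{i:}$ is the $i$-th row of $M$ and $\|\cdot\|_p$ is the $p$-norm. This function is differentiable on $\mathbb{R}^n$, and its gradient is the column vector $\nabla V_{M,p}(x) = M^\top w$ with $w_i = |M_{i:}x|^{p-1}\,\mathrm{sign}(M_{i:}x)$. The inner product is $\langle x,y\rangle := x^\top y$. A square real matrix is Hurwitz if all its eigenvalues have negative real part. *)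

theory Defs
  imports "HOL-Analysis.Derivative" "Jordan_Normal_Form.DL_Rank" "Jordan_Normal_Form.Char_Poly"
begin

text \<open>Both libraries claim the infix bullet and dollar; in this theory they denote
  \<^const>\<open>scalar_prod\<close> and \<^const>\<open>vec_index\<close>.\<close>

unbundle no inner_syntax
unbundle no vec_syntax

text \<open>The complex eigenvalues of the real matrix count.\<close>

definition Hurwitz :: "real mat \<Rightarrow> bool" where
  "Hurwitz A \<longleftrightarrow> square_mat A \<and>
    (\<forall>k. eigenvalue (map_mat complex_of_real A) k \<longrightarrow> Re k < 0)"

text \<open>The first argument of \<^const>\<open>vec_space.rank\<close> is the dimension of the space in which
  the columns live.\<close>

definition full_column_rank :: "real mat \<Rightarrow> bool" where
  "full_column_rank M \<longleftrightarrow> vec_space.rank (dim_row M) M = dim_col M"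

definition lyap :: "real mat \<Rightarrow> real \<Rightarrow> real vec \<Rightarrow> real" where
  "lyap M p x = (1 / p) * (\<Sum>i<dim_row M. \<bar>row M i \<bullet> x\<bar> powr p)"

text \<open>The type \<^typ>\<open>real vec\<close> contains vectors of all dimensions and carries no norm, so the
  gradient is the vector of partial derivatives, in the space \<^term>\<open>x\<close> belongs to.\<close>

definition gradient :: "(real vec \<Rightarrow> real) \<Rightarrow> real vec \<Rightarrow> real vec" where
  "gradient f x =
    vec (dim_vec x) (\<lambda>j. deriv (\<lambda>t. f (x + t \<cdot>\<^sub>v unit_vec (dim_vec x) j)) 0)"

lemma has_real_derivative_abs_powr:
  fixes p u :: real
  assumes p: "1 < p"
  shows "((\<lambda>u. \<bar>u\<bar> powr p) has_real_derivative p * (\<bar>u\<bar> powr (p - 1) * sgn u)) (at u)"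
proof (cases u "0::real" rule: linorder_cases)
  case greater
  have "((\<lambda>u. u powr p) has_real_derivative p * (u powr (p - 1))) (at u)"
    using has_real_derivative_powr[OF greater, of p] by simp
  moreover have "\<forall>\<^sub>F v in nhds u. v powr p = \<bar>v\<bar> powr p"
    using eventually_nhds_in_open[of "{0<..}" u] greater by (auto elim!: eventually_mono)
  ultimately show ?thesis using greater
    by (subst DERIV_cong_ev[OF refl _ refl, of _ "\<lambda>u. u powr p"]) (auto elim!: eventually_mono)
next
  case less
  have "((\<lambda>u. (- u) powr p) has_real_derivative p * (- u) powr (p - 1) * (- 1)) (at u)"
    using less by (auto intro!: derivative_eq_intros simp: field_simps powr_diff)
  moreover have "\<forall>\<^sub>F v in nhds u. (- v) powr p = \<bar>v\<bar> powr p"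
    using eventually_nhds_in_open[of "{..<0}" u] less by (auto elim!: eventually_mono)
  ultimately show ?thesis using less
    by (subst DERIV_cong_ev[OF refl _ refl, of _ "\<lambda>u. (- u) powr p"]) (auto elim!: eventually_mono)
next
  case equal
  have "((\<lambda>h::real. \<bar>h\<bar> powr (p - 1)) \<longlongrightarrow> 0) (at 0)"
    by (rule tendsto_eq_intros tendsto_zero_powrI tendsto_const | use p in auto)+
  then have "((\<lambda>h::real. \<bar>h\<bar> powr p / h) \<longlongrightarrow> 0) (at 0)"
    by (rule Lim_transform_bound[rotated])
       (auto simp: eventually_at_filter powr_diff abs_if)
  then show ?thesis using equal p by (simp add: DERIV_def)
qed

lemma lyap_has_directional_derivative:
  assumes p: "1 < p" and M: "M \<in> carrier_mat m n"
    and x: "x \<in> carrier_vec n" and h: "h \<in> carrier_vec n"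
  shows "((\<lambda>t. lyap M p (x + t \<cdot>\<^sub>v h)) has_real_derivative
    (transpose_mat M *\<^sub>v vec m (\<lambda>i. \<bar>row M i \<bullet> x\<bar> powr (p - 1) * sgn (row M i \<bullet> x))) \<bullet> h) (at 0)"
    (is "(_ has_real_derivative (_ *\<^sub>v ?w) \<bullet> _) _")
proof -
  have lin: "row M i \<bullet> (x + t \<cdot>\<^sub>v h) = row M i \<bullet> x + t * (row M i \<bullet> h)" if "i < m" for i t
  proof -
    have "row M i \<in> carrier_vec n" using M that by auto
    then show ?thesis using x h by (simp add: scalar_prod_add_distrib[of _ n])
  qed
  have der: "((\<lambda>t. \<bar>row M i \<bullet> x + t * (row M i \<bullet> h)\<bar> powr p) has_real_derivative
      p * (?w $ i) * (row M i \<bullet> h)) (at 0)" if "i < m" for i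
  proof -
    have "((\<lambda>u. \<bar>u\<bar> powr p) has_real_derivative p * (?w $ i)) (at (row M i \<bullet> x + 0 * (row M i \<bullet> h)))"
      using has_real_derivative_abs_powr[OF p] that by simp
    moreover have "((\<lambda>t. row M i \<bullet> x + t * (row M i \<bullet> h)) has_real_derivative (row M i \<bullet> h)) (at 0)"
      by (auto intro!: derivative_eq_intros)
    ultimately show ?thesis by (rule DERIV_chain2)
  qed
  have "((\<lambda>t. (1 / p) * (\<Sum>i<m. \<bar>row M i \<bullet> x + t * (row M i \<bullet> h)\<bar> powr p)) has_real_derivative
      (1 / p) * (\<Sum>i<m. p * (?w $ i) * (row M i \<bullet> h))) (at 0)"
    by (intro DERIV_cmult DERIV_sum der) simp
  also have "(1 / p) * (\<Sum>i<m. p * (?w $ i) * (row M i \<bullet> h)) = (\<Sum>i<m. ?w $ i * (row M i \<bullet> h))"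
    using p by (simp add: sum_distrib_left mult.assoc)
  also have "\<dots> = ?w \<bullet> (M *\<^sub>v h)"
    unfolding scalar_prod_def[of ?w "M *\<^sub>v h"] using M by (auto simp: atLeast0LessThan intro!: sum.cong)
  also have "\<dots> = (transpose_mat M *\<^sub>v ?w) \<bullet> h"
    using transpose_vec_mult_scalar[of M m n h ?w] M h
    by (auto simp: comm_scalar_prod[of _ m _])
  finally have "((\<lambda>t. (1 / p) * (\<Sum>i<m. \<bar>row M i \<bullet> x + t * (row M i \<bullet> h)\<bar> powr p))
      has_real_derivative (transpose_mat M *\<^sub>v ?w) \<bullet> h) (at 0)" .
  moreover have "(\<lambda>t. lyap M p (x + t \<cdot>\<^sub>v h)) =
      (\<lambda>t. (1 / p) * (\<Sum>i<m. \<bar>row M i \<bullet> x + t * (row M i \<bullet> h)\<bar> powr p))"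
    using M lin by (auto simp: lyap_def)
  ultimately show ?thesis by simp
qed

lemma gradient_lyap:
  assumes p: "1 < p" and M: "M \<in> carrier_mat m n" and x: "x \<in> carrier_vec n"
  shows "gradient (lyap M p) x =
    transpose_mat M *\<^sub>v vec m (\<lambda>i. \<bar>row M i \<bullet> x\<bar> powr (p - 1) * sgn (row M i \<bullet> x))"
    (is "_ = ?g")
proof (rule eq_vecI)
  show "dim_vec (gradient (lyap M p) x) = dim_vec ?g"
    using M x by (simp add: gradient_def)
next
  fix j assume "j < dim_vec ?g"
  then have j: "j < n" using M by simp
  have g: "?g \<in> carrier_vec n" using M by auto
  have "deriv (\<lambda>t. lyap M p (x + t \<cdot>\<^sub>v unit_vec n j)) 0 = ?g \<bullet> unit_vec n j"
    by (rule DERIV_imp_deriv, rule lyap_has_directional_derivative[OF p M x]) simp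
  also have "\<dots> = ?g $ j" using g j by (rule scalar_prod_right_unit[OF j, of ?g] | simp)+
  finally show "gradient (lyap M p) x $ j = ?g $ j"
    using x j by (simp add: gradient_def)
qed

end

theory Submission
  imports Defs "Jordan_Normal_Form.Spectral_Radius"
begin

text \<open>Write \<open>V\<^sub>M\<close> for \<open>lyap M p\<close>.

  If \<open>A\<close> is Hurwitz, \<open>R\<close> is built from the explicit Euler scheme. For a small step
  \<open>h > 0\<close> the Euler matrix \<open>B = 1 + h A\<close> has all its eigenvalues in the open unit disc, since
  \<open>|1 + h k|\<^sup>2 = 1 + 2 h Re k + h\<^sup>2 |k|\<^sup>2\<close>. Hence the powers of \<open>B\<close> tend to zero and some
  \<open>B^N\<close> at least halves \<open>V\<^sub>1\<close>. Let \<open>R\<close> consist of \<open>1, B, ..., B^(N-1)\<close> stacked on top of each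
  other, so that \<open>V\<^sub>R\<close> sums \<open>V\<^sub>1\<close> along the first \<open>N\<close> points of an Euler trajectory. The
  difference \<open>V\<^sub>R (B x) - V\<^sub>R x\<close> telescopes to \<open>V\<^sub>1 (B^N x) - V\<^sub>1 x \<le> - V\<^sub>1 x / 2\<close>. Because
  \<open>V\<^sub>R\<close> is convex and \<open>B x = x + h A x\<close>, the inner product of its gradient with \<open>h A x\<close> is at
  most this difference (\<open>lyap_above_tangent\<close>). So a multiple of the identity serves as \<open>S\<close>.

  Conversely, suppose that the inequality holds and \<open>k\<close> is an eigenvalue with \<open>Re k \<ge> 0\<close> and
  eigenvector \<open>v\<close>. Along the solution \<open>y t = Re (exp (k t) v)\<close> the function \<open>V\<^sub>R\<close> never
  increases, and it strictly decreases at time \<open>0\<close>. But after a full rotation of \<open>exp (k t)\<close>, or any time if \<open>k\<close> is real,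
  the point \<open>y T\<close> is a multiple of \<open>y 0\<close> by a factor at least \<open>1\<close>, so \<open>V\<^sub>R\<close> cannot have
  become smaller.\<close>

section \<open>Convexity and homogeneity of the Lyapunov functions\<close>

text \<open>The supporting-line inequality of \<open>|z|^p / p\<close> at \<open>y\<close>. It is Young's inequality for \<open>|z|\<close> and
  \<open>|y|^(p - 1)\<close>, which also covers \<open>y = 0\<close>.\<close>

lemma abs_powr_above_tangent:
  fixes y z p :: real
  assumes p: "1 < p"
  shows "\<bar>y\<bar> powr p / p + \<bar>y\<bar> powr (p - 1) * sgn y * (z - y) \<le> \<bar>z\<bar> powr p / p"
proof -
  define q where "q = p / (p - 1)"
  have q: "1 < q" "1 / p + 1 / q = 1" "(p - 1) * q = p" 
    using p by (auto simp: q_def field_simps)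
  have "\<bar>z\<bar> * \<bar>y\<bar> powr (p - 1) \<le> \<bar>z\<bar> powr p / p + (\<bar>y\<bar> powr (p - 1)) powr q / q"
    using p q by (intro Youngs_inequality) auto
  also have "(\<bar>y\<bar> powr (p - 1)) powr q = \<bar>y\<bar> powr p"
    using q by (simp add: powr_powr)
  finally have young: "\<bar>z\<bar> * \<bar>y\<bar> powr (p - 1) \<le> \<bar>z\<bar> powr p / p + \<bar>y\<bar> powr p / q" .
  have "sgn y * z \<le> \<bar>z\<bar>" by (auto simp: sgn_if)
  then have "\<bar>y\<bar> powr (p - 1) * (sgn y * z) \<le> \<bar>y\<bar> powr (p - 1) * \<bar>z\<bar>"
    by (intro mult_left_mono) auto
  moreover have "sgn y * y = \<bar>y\<bar>" by (auto simp: sgn_if)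
  then have "\<bar>y\<bar> powr (p - 1) * (sgn y * y) = \<bar>y\<bar> powr p"
    using p by (simp add: powr_diff)
  moreover have "\<bar>y\<bar> powr p / q = \<bar>y\<bar> powr p - \<bar>y\<bar> powr p / p"
    using p by (simp add: q_def field_simps)
  ultimately show ?thesis using young by (simp add: algebra_simps)
qed

lemma gradient_lyap_inner:
  assumes p: "1 < p" and M: "M \<in> carrier_mat m n"
    and x: "x \<in> carrier_vec n" and h: "h \<in> carrier_vec n"
  shows "gradient (lyap M p) x \<bullet> h =
    (\<Sum>i<m. \<bar>row M i \<bullet> x\<bar> powr (p - 1) * sgn (row M i \<bullet> x) * (row M i \<bullet> h))"
proof -
  let ?w = "vec m (\<lambda>i. \<bar>row M i \<bullet> x\<bar> powr (p - 1) * sgn (row M i \<bullet> x))"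
  have "gradient (lyap M p) x \<bullet> h = ?w \<bullet> (M *\<^sub>v h)"
    using transpose_vec_mult_scalar[of M m n h ?w] M h
    by (simp add: gradient_lyap[OF p M x] comm_scalar_prod[of _ m])
  also have "\<dots> = (\<Sum>i<m. \<bar>row M i \<bullet> x\<bar> powr (p - 1) * sgn (row M i \<bullet> x) * (row M i \<bullet> h))"
    unfolding scalar_prod_def[of ?w] using M by (auto simp: atLeast0LessThan intro!: sum.cong)
  finally show ?thesis .
qed

text \<open>Convexity, in the only form in which it is used: it turns a finite difference of \<open>lyap M p\<close> into
  a bound on a directional derivative.\<close>

lemma lyap_above_tangent:
  assumes p: "1 < p" and M: "M \<in> carrier_mat m n"
    and x: "x \<in> carrier_vec n" and h: "h \<in> carrier_vec n"
  shows "lyap M p x + gradient (lyap M p) x \<bullet> h \<le> lyap M p (x + h)"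
proof -
  have "(\<Sum>i<m. \<bar>row M i \<bullet> x\<bar> powr p / p +
      \<bar>row M i \<bullet> x\<bar> powr (p - 1) * sgn (row M i \<bullet> x) * (row M i \<bullet> h))
    \<le> (\<Sum>i<m. \<bar>row M i \<bullet> (x + h)\<bar> powr p / p)"
  proof (rule sum_mono)
    fix i assume "i \<in> {..<m}"
    then have "row M i \<in> carrier_vec n" using M by auto
    then have "row M i \<bullet> (x + h) = row M i \<bullet> x + row M i \<bullet> h"
      using x h by (simp add: scalar_prod_add_distrib)
    then show "\<bar>row M i \<bullet> x\<bar> powr p / p +
      \<bar>row M i \<bullet> x\<bar> powr (p - 1) * sgn (row M i \<bullet> x) * (row M i \<bullet> h)
      \<le> \<bar>row M i \<bullet> (x + h)\<bar> powr p / p"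
      using abs_powr_above_tangent[OF p, of "row M i \<bullet> x" "row M i \<bullet> (x + h)"] by simp
  qed
  then show ?thesis using M
    by (simp add: gradient_lyap_inner[OF p M x h] lyap_def sum.distrib sum_divide_distrib)
qed

lemma lyap_smult:
  assumes x: "x \<in> carrier_vec (dim_col M)"
  shows "lyap M p (c \<cdot>\<^sub>v x) = \<bar>c\<bar> powr p * lyap M p x"
proof -
  have "row M i \<bullet> (c \<cdot>\<^sub>v x) = c * (row M i \<bullet> x)" if "i < dim_row M" for i
    using x that by (intro scalar_prod_smult_distrib[where n="dim_col M"]) auto
  then show ?thesis
    by (simp add: lyap_def abs_mult powr_mult sum_distrib_left mult.left_commute)
qed

lemma lyap_nonneg: "0 < p \<Longrightarrow> 0 \<le> lyap M p x"
  by (simp add: lyap_def sum_nonneg)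

section \<open>Full column rank and positivity\<close>

text \<open>Since \<^const>\<open>vec_space.rank\<close> is the dimension of the span of a set, repeated columns are a
  case of their own: they lower the rank, and the difference of two unit vectors is in the kernel.\<close>

lemma full_column_rank_iff_trivial_kernel:
  assumes M: "M \<in> carrier_mat m n"
  shows "full_column_rank M \<longleftrightarrow> (\<forall>v \<in> carrier_vec n. M *\<^sub>v v = 0\<^sub>v m \<longrightarrow> v = 0\<^sub>v n)"
proof -
  interpret vec_space "TYPE(real)" m .
  have rank: "full_column_rank M \<longleftrightarrow> rank M = n"
    using M by (simp add: full_column_rank_def)
  show ?thesis
  proof (cases "distinct (cols M)")
    case True
    have "lin_indpt (set (cols M)) \<longleftrightarrow> rank M = n"
      using lin_indpt_full_rank[OF M True] full_rank_lin_indpt[OF M _ True] by blast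
    moreover have "lin_dep (set (cols M)) \<longleftrightarrow> (\<exists>v \<in> carrier_vec n. M *\<^sub>v v = 0\<^sub>v m \<and> v \<noteq> 0\<^sub>v n)"
      using lin_depI[OF M _ _ _ True] lin_depE[OF M _ True] by metis
    ultimately show ?thesis using rank by blast
  next
    case False
    obtain S where S: "maximal S (\<lambda>T. T \<subseteq> set (cols M) \<and> lin_indpt T)"
      using maximal_exists[of "(\<lambda>T. T \<subseteq> set (cols M) \<and> lin_indpt T)" "card (set (cols M))" "{}"]
      by (meson List.finite_set card_mono empty_iff empty_subsetI finite_lin_indpt2 rev_finite_subset)
    have "card S \<le> card (set (cols M))"
      using S by (simp add: card_mono maximal_def)
    also have "\<dots> < n"
      using False M card_distinct[of "cols M"] card_length[of "cols M"] by (auto simp: order_less_le)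
    finally have low: "rank M \<noteq> n" using rank_card_indpt[OF M S] by simp
    obtain i j where ij: "i < n" "j < n" "i \<noteq> j" "col M i = col M j"
      using False M by (auto simp: distinct_conv_nth)
    moreover have "M *\<^sub>v (unit_vec n i - unit_vec n j) = 0\<^sub>v m"
    proof (rule eq_vecI)
      fix r assume r: "r < dim_vec (0\<^sub>v m :: real vec)"
      then have row: "row M r \<in> carrier_vec n" using M by auto
      have "M $$ (r, i) = M $$ (r, j)"
        using arg_cong[OF ij(4), of "\<lambda>w. w $ r"] ij(1,2) r M by simp
      then show "(M *\<^sub>v (unit_vec n i - unit_vec n j)) $ r = 0\<^sub>v m $ r"
        using M r ij(1-3) row
        by (simp add: scalar_prod_minus_distrib[OF row] scalar_prod_right_unit)
    qed (use M in simp)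
    moreover have "(unit_vec n i - unit_vec n j :: real vec) \<noteq> 0\<^sub>v n"
    proof
      assume "(unit_vec n i - unit_vec n j :: real vec) = 0\<^sub>v n"
      then have "(unit_vec n i - unit_vec n j :: real vec) $ i = 0\<^sub>v n $ i" by simp
      then show False using ij by simp
    qed
    ultimately show ?thesis using rank low
      by (meson minus_carrier_vec unit_vec_carrier)
  qed
qed

lemma lyap_pos:
  assumes p: "1 < p" and M: "M \<in> carrier_mat m n" and "full_column_rank M"
    and x: "x \<in> carrier_vec n" "x \<noteq> 0\<^sub>v n"
  shows "0 < lyap M p x"
proof -
  have "M *\<^sub>v x \<noteq> 0\<^sub>v m"
    using assms full_column_rank_iff_trivial_kernel[OF M] by blast
  then obtain i where i: "i < m" "row M i \<bullet> x \<noteq> 0"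
    using M by (auto simp: vec_eq_iff)
  then have "0 < (\<Sum>i<m. \<bar>row M i \<bullet> x\<bar> powr p)"
    by (intro sum_pos2[of _ i]) auto
  then show ?thesis using p M by (simp add: lyap_def)
qed

section \<open>Matrices with all eigenvalues in the open unit disc\<close>

lemma eigenvalue_smult_matD:
  fixes c :: "'a :: field"
  assumes A: "A \<in> carrier_mat n n" and c: "c \<noteq> 0" and ev: "eigenvalue (c \<cdot>\<^sub>m A) k"
  shows "eigenvalue A (k / c)"
proof -
  obtain v where v: "v \<in> carrier_vec n" "v \<noteq> 0\<^sub>v n" "(c \<cdot>\<^sub>m A) *\<^sub>v v = k \<cdot>\<^sub>v v"
    using ev A by (auto simp: eigenvalue_def eigenvector_def)
  have "A *\<^sub>v v = (1 / c) \<cdot>\<^sub>v ((c \<cdot>\<^sub>m A) *\<^sub>v v)"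
    using A v(1) c by (intro eq_vecI) auto
  also have "\<dots> = (k / c) \<cdot>\<^sub>v v"
    using v by (simp add: smult_smult_assoc)
  finally show ?thesis
    using A v by (auto simp: eigenvalue_def eigenvector_def)
qed

lemma smult_pow_mat:
  fixes c :: "'a :: comm_ring_1"
  assumes A: "A \<in> carrier_mat n n"
  shows "(c \<cdot>\<^sub>m A) ^\<^sub>m k = c ^ k \<cdot>\<^sub>m (A ^\<^sub>m k)"
proof (induction k)
  case 0
  then show ?case using A by auto
next
  case (Suc k)
  have "A ^\<^sub>m k \<in> carrier_mat n n" using A by simp
  then show ?case using Suc A
    by (auto intro!: eq_matI simp: mult_smult_distrib[of _ n n _ n] mult_smult_assoc_mat[of _ n n _ n])
qed

text \<open>The powers of a matrix of spectral radius below \<open>1\<close> are bounded. For \<open>A / \<rho>\<close>, with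
  \<open>\<rho> < 1\<close> still above all eigenvalue moduli, this bound gives decay like \<open>\<rho>^k\<close>.\<close>

lemma pow_mat_tendsto_0:
  assumes A: "A \<in> carrier_mat n n"
    and ev: "\<And>k. eigenvalue A k \<Longrightarrow> cmod k < 1"
    and ij: "i < n" "j < n"
  shows "(\<lambda>k. (A ^\<^sub>m k) $$ (i, j)) \<longlonglongrightarrow> 0"
proof -
  have "\<forall>\<^sub>F \<rho>::real in at_left 1. \<forall>k\<in>spectrum A. cmod k < \<rho>"
  proof (rule eventually_ball_finite)
    show "finite (spectrum A)" by (rule card_finite_spectrum[OF A])
    show "\<forall>k\<in>spectrum A. \<forall>\<^sub>F \<rho> in at_left 1. cmod k < \<rho>"
    proof
      fix k assume "k \<in> spectrum A"
      then have "cmod k < 1" using ev by (simp add: spectrum_def)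
      from eventually_at_left_real[OF this] show "\<forall>\<^sub>F \<rho> in at_left 1. cmod k < \<rho>"
        by (rule eventually_mono) auto
    qed
  qed
  moreover have "\<forall>\<^sub>F \<rho>::real in at_left 1. \<rho> \<in> {0<..<1}"
    by (rule eventually_at_left_real) simp
  ultimately have "\<forall>\<^sub>F \<rho>::real in at_left 1. \<rho> \<in> {0<..<1} \<and> (\<forall>k\<in>spectrum A. cmod k < \<rho>)"
    by eventually_elim simp
  then obtain \<rho> :: real where \<rho>: "0 < \<rho>" "\<rho> < 1" "\<forall>k\<in>spectrum A. cmod k < \<rho>"
    using eventually_happens'[of "at_left (1::real)"] by (auto simp: trivial_limit_at_left_real)
  define D where "D = complex_of_real (1 / \<rho>) \<cdot>\<^sub>m A"
  have D: "D \<in> carrier_mat n n" using A by (simp add: D_def)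
  have "spectral_radius D < 1"
  proof -
    have "spectral_radius D \<in> norm ` spectrum D"
      using ij by (intro spectral_radius_mem_max[OF D]) simp
    then obtain k where k: "eigenvalue D k" "spectral_radius D = cmod k"
      by (auto simp: spectrum_def)
    have "eigenvalue A (k / complex_of_real (1 / \<rho>))"
      using k \<rho> by (intro eigenvalue_smult_matD[OF A]) (auto simp: D_def)
    then have "cmod (k / complex_of_real (1 / \<rho>)) < \<rho>"
      using \<rho> by (simp add: spectrum_def)
    then show ?thesis using \<rho> k by (simp add: norm_divide norm_mult)
  qed
  then obtain c where c: "\<And>k. norm_bound (D ^\<^sub>m k) c"
    using spectral_radius_jnf_norm_bound_less_1_upper_triangular[OF D] by blast
  have bound: "cmod ((A ^\<^sub>m k) $$ (i, j)) \<le> \<rho> ^ k * c" for k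
  proof -
    have "cmod ((D ^\<^sub>m k) $$ (i, j)) \<le> c"
      using c[of k] ij D by (auto simp: norm_bound_def)
    then show ?thesis using \<rho> ij A
      by (simp add: D_def smult_pow_mat[OF A] norm_mult norm_power power_divide norm_divide field_simps)
  qed
  have "(\<lambda>k. \<rho> ^ k * c) \<longlonglongrightarrow> 0"
    using \<rho> by (intro tendsto_mult_left_zero LIMSEQ_realpow_zero) auto
  then show ?thesis
    by (rule Lim_null_comparison[rotated]) (use bound in auto)
qed

lemma eigenvalue_one_plus_smultD:
  fixes A :: "'a :: field mat"
  assumes A: "A \<in> carrier_mat n n" and c: "c \<noteq> 0"
    and ev: "eigenvalue (1\<^sub>m n + c \<cdot>\<^sub>m A) k"
  shows "eigenvalue A ((k - 1) / c)"
proof -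
  obtain v where v: "v \<in> carrier_vec n" "v \<noteq> 0\<^sub>v n" "(1\<^sub>m n + c \<cdot>\<^sub>m A) *\<^sub>v v = k \<cdot>\<^sub>v v"
    using ev A by (auto simp: eigenvalue_def eigenvector_def)
  have "(1\<^sub>m n + c \<cdot>\<^sub>m A) *\<^sub>v v = v + (c \<cdot>\<^sub>m A) *\<^sub>v v"
    using A v by (simp add: add_mult_distrib_mat_vec[of _ n n])
  then have "v + (c \<cdot>\<^sub>m A) *\<^sub>v v = k \<cdot>\<^sub>v v" using v by simp
  then have coord: "(v + (c \<cdot>\<^sub>m A) *\<^sub>v v) $ i = (k \<cdot>\<^sub>v v) $ i" for i by simp
  have "(c \<cdot>\<^sub>m A) *\<^sub>v v = (k - 1) \<cdot>\<^sub>v v"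
  proof (rule eq_vecI)
    fix i assume "i < dim_vec ((k - 1) \<cdot>\<^sub>v v)"
    then show "((c \<cdot>\<^sub>m A) *\<^sub>v v) $ i = ((k - 1) \<cdot>\<^sub>v v) $ i"
      using coord[of i] A v(1) by (simp add: algebra_simps)
  qed (use A v(1) in simp)
  then have "eigenvalue (c \<cdot>\<^sub>m A) (k - 1)"
    using A v by (auto simp: eigenvalue_def eigenvector_def)
  then show ?thesis by (rule eigenvalue_smult_matD[OF A c])
qed

section \<open>The Euler matrix of a Hurwitz matrix\<close>

text \<open>The eigenvalues \<open>1 + h k\<close> of the Euler matrix enter the unit disc as \<open>h\<close> decreases to \<open>0\<close>,
  and a common step size exists because there are finitely many \<open>k\<close>.\<close>

lemma Hurwitz_imp_Euler_step_contractive: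
  assumes A: "A \<in> carrier_mat n n" and H: "Hurwitz A"
  obtains h where "0 < h"
    "\<And>k. eigenvalue (map_mat complex_of_real (1\<^sub>m n + h \<cdot>\<^sub>m A)) k \<Longrightarrow> cmod k < 1"
proof -
  let ?C = "map_mat complex_of_real A"
  have C: "?C \<in> carrier_mat n n" using A by simp
  have "\<forall>\<^sub>F h::real in at_right 0. \<forall>k\<in>spectrum ?C. cmod (1 + of_real h * k) < 1"
  proof (rule eventually_ball_finite)
    show "finite (spectrum ?C)" by (rule card_finite_spectrum[OF C])
    show "\<forall>k\<in>spectrum ?C. \<forall>\<^sub>F h::real in at_right 0. cmod (1 + of_real h * k) < 1"
    proof
      fix k assume "k \<in> spectrum ?C"
      then have k: "Re k < 0" using H by (simp add: Hurwitz_def spectrum_def)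
      then have k0: "0 < (cmod k)\<^sup>2" by auto
      then have "0 < - 2 * Re k / (cmod k)\<^sup>2" using k by (intro divide_pos_pos) auto
      from eventually_at_right_real[OF this]
      show "\<forall>\<^sub>F h::real in at_right 0. cmod (1 + of_real h * k) < 1"
      proof (rule eventually_mono)
        fix h assume h: "h \<in> {0<..<- 2 * Re k / (cmod k)\<^sup>2}"
        then have "0 < h" "h * (cmod k)\<^sup>2 < - 2 * Re k"
          using k0 by (simp_all only: greaterThanLessThan_iff pos_less_divide_eq)
        then have "h * (h * (cmod k)\<^sup>2) < h * (- 2 * Re k)"
          by (intro mult_strict_left_mono)
        moreover have "(cmod (1 + of_real h * k))\<^sup>2 = 1 + 2 * h * Re k + h * (h * (cmod k)\<^sup>2)"
          by (simp only: cmod_power2) (simp add: power2_eq_square algebra_simps)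
        ultimately have "(cmod (1 + of_real h * k))\<^sup>2 < 1\<^sup>2"
          by simp
        then show "cmod (1 + of_real h * k) < 1"
          by (rule power2_less_imp_less) simp
      qed
    qed
  qed
  moreover have "\<forall>\<^sub>F h::real in at_right 0. 0 < h"
    by (rule eventually_at_right_less)
  ultimately have "\<forall>\<^sub>F h::real in at_right 0. 0 < h \<and> (\<forall>k\<in>spectrum ?C. cmod (1 + of_real h * k) < 1)"
    by eventually_elim simp
  then obtain h :: real where h: "0 < h" "\<forall>k\<in>spectrum ?C. cmod (1 + of_real h * k) < 1"
    using eventually_happens'[of "at_right (0::real)"] by (auto simp: trivial_limit_at_right_real)
  show thesis
  proof (rule that[OF h(1)])
    fix k assume k: "eigenvalue (map_mat complex_of_real (1\<^sub>m n + h \<cdot>\<^sub>m A)) k"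
    have "map_mat complex_of_real (1\<^sub>m n + h \<cdot>\<^sub>m A) = 1\<^sub>m n + of_real h \<cdot>\<^sub>m ?C"
      using A by (intro eq_matI) auto
    then have "eigenvalue ?C ((k - 1) / of_real h)"
      using k h by (intro eigenvalue_one_plus_smultD[OF C]) auto
    then show "cmod k < 1"
      using h by (force simp: spectrum_def)
  qed
qed

section \<open>Stacking the powers of a matrix\<close>

lemma lyap_pow_mat_contractive:
  assumes p: "1 < p" and B: "B \<in> carrier_mat n n"
    and lim: "\<And>i j. i < n \<Longrightarrow> j < n \<Longrightarrow> (\<lambda>k. (B ^\<^sub>m k) $$ (i, j)) \<longlonglongrightarrow> 0"
  obtains N where "\<And>x. x \<in> carrier_vec n \<Longrightarrow> lyap (B ^\<^sub>m N) p x \<le> lyap (1\<^sub>m n) p x / 2"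
proof -
  \<comment> \<open>With entries below \<open>\<epsilon>\<close>, each coordinate contributes at most \<open>(n \<epsilon>)^p F\<close>, where \<open>F\<close> is the sum of
    \<open>|x $ j|^p\<close>. This choice makes the \<open>n\<close> coordinates together at most \<open>F / 2\<close>; the shift to
    \<open>n + 1\<close> keeps \<open>\<epsilon>\<close> positive for \<open>n = 0\<close>.\<close>
  define \<delta> :: real where "\<delta> = (1 / (2 * (real n + 1))) powr (1 / p)"
  define \<epsilon> where "\<epsilon> = \<delta> / (real n + 1)"
  have \<delta>: "0 < \<delta>" "\<delta> powr p = 1 / (2 * (real n + 1))"
    using p by (auto simp: \<delta>_def powr_powr)
  have \<epsilon>: "0 < \<epsilon>" "real n * \<epsilon> \<le> \<delta>"
    using \<delta> by (auto simp: \<epsilon>_def field_simps)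
  have "\<forall>\<^sub>F k in sequentially. \<forall>i\<in>{..<n}. \<forall>j\<in>{..<n}. \<bar>(B ^\<^sub>m k) $$ (i, j)\<bar> < \<epsilon>"
    using lim \<epsilon> by (intro eventually_ball_finite ballI) (auto simp: tendsto_iff dist_real_def)
  then obtain N where N: "\<And>i j. i < n \<Longrightarrow> j < n \<Longrightarrow> \<bar>(B ^\<^sub>m N) $$ (i, j)\<bar> < \<epsilon>"
    by (auto simp: eventually_sequentially)
  have BN: "B ^\<^sub>m N \<in> carrier_mat n n" using B by simp
  show thesis
  proof (rule that)
    fix x :: "real vec" assume x: "x \<in> carrier_vec n"
    define F where "F = (\<Sum>j<n. \<bar>x $ j\<bar> powr p)"
    have F0: "0 \<le> F" by (simp add: F_def sum_nonneg)
    have coord: "\<bar>x $ j\<bar> \<le> F powr (1 / p)" if "j < n" for j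
    proof -
      have "\<bar>x $ j\<bar> powr p \<le> F"
        unfolding F_def using that by (intro member_le_sum) auto
      then have "(\<bar>x $ j\<bar> powr p) powr (1 / p) \<le> F powr (1 / p)"
        using p by (intro powr_mono2) auto
      then show ?thesis using p by (simp add: powr_powr)
    qed
    have row: "\<bar>row (B ^\<^sub>m N) i \<bullet> x\<bar> powr p \<le> F / (2 * (real n + 1))" if i: "i < n" for i
    proof -
      have "row (B ^\<^sub>m N) i \<bullet> x = (\<Sum>j<n. (B ^\<^sub>m N) $$ (i, j) * x $ j)"
        using i x carrier_matD[OF BN] by (auto simp: scalar_prod_def atLeast0LessThan intro!: sum.cong)
      also have "\<bar>\<dots>\<bar> \<le> (\<Sum>j<n. \<bar>(B ^\<^sub>m N) $$ (i, j) * x $ j\<bar>)" by (rule sum_abs)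
      also have "\<dots> \<le> (\<Sum>j<n. \<epsilon> * F powr (1 / p))"
        using N[OF i] coord \<epsilon> unfolding abs_mult
        by (intro sum_mono mult_mono) (auto intro: less_imp_le)
      also have "\<dots> = (real n * \<epsilon>) * F powr (1 / p)" by simp
      also have "\<dots> \<le> \<delta> * F powr (1 / p)"
        using \<epsilon> by (intro mult_right_mono) auto
      finally have "\<bar>row (B ^\<^sub>m N) i \<bullet> x\<bar> powr p \<le> (\<delta> * F powr (1 / p)) powr p"
        using p by (intro powr_mono2) auto
      also have "\<dots> = F / (2 * (real n + 1))"
        using \<delta> F0 p by (simp add: powr_mult powr_powr)
      finally show ?thesis .
    qed
    have "(\<Sum>i<n. \<bar>row (B ^\<^sub>m N) i \<bullet> x\<bar> powr p) \<le> (\<Sum>i<n. F / (2 * (real n + 1)))"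
      using row by (intro sum_mono) auto
    also have "\<dots> \<le> F / 2"
      using F0 by (simp add: field_simps mult_left_mono)
    finally have "(\<Sum>i<n. \<bar>row (B ^\<^sub>m N) i \<bullet> x\<bar> powr p) \<le> F / 2" .
    moreover have "(\<Sum>i<n. \<bar>row (1\<^sub>m n) i \<bullet> x\<bar> powr p) = F"
      unfolding F_def using x by (intro sum.cong) (auto simp: scalar_prod_left_unit)
    ultimately show "lyap (B ^\<^sub>m N) p x \<le> lyap (1\<^sub>m n) p x / 2"
      using p carrier_matD[OF BN] by (simp add: lyap_def field_simps del: row_one pow_mat_dim)
  qed
qed

definition stack_powers :: "real mat \<Rightarrow> nat \<Rightarrow> real mat" where
  "stack_powers B N = (let n = dim_row B in
    mat (N * n) n (\<lambda>(q, j). (B ^\<^sub>m (q div n)) $$ (q mod n, j)))"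

lemma lyap_stack_powers:
  assumes B: "B \<in> carrier_mat n n"
  shows "lyap (stack_powers B N) p x = (\<Sum>k<N. lyap (B ^\<^sub>m k) p x)"
proof -
  have dim: "B ^\<^sub>m k \<in> carrier_mat n n" for k using B by simp
  have row: "row (stack_powers B N) (k * n + i) = row (B ^\<^sub>m k) i" if "k < N" "i < n" for k i
  proof -
    have "k * n + i < Suc k * n" using that by simp
    also have "\<dots> \<le> N * n" using that by (intro mult_le_mono1) simp
    finally show ?thesis using that carrier_matD[OF B] carrier_matD[OF dim[of k]]
      by (intro eq_vecI) (auto simp: stack_powers_def Let_def)
  qed
  have "(\<Sum>q<N * n. \<bar>row (stack_powers B N) q \<bullet> x\<bar> powr p)
    = (\<Sum>k<N. \<Sum>q=k * n..<k * n + n. \<bar>row (stack_powers B N) q \<bullet> x\<bar> powr p)"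
    by (rule sum.nat_group[symmetric])
  also have "\<dots> = (\<Sum>k<N. \<Sum>i<n. \<bar>row (B ^\<^sub>m k) i \<bullet> x\<bar> powr p)"
  proof (rule sum.cong[OF refl])
    fix k assume k: "k \<in> {..<N}"
    have "(\<Sum>q=k * n..<k * n + n. \<bar>row (stack_powers B N) q \<bullet> x\<bar> powr p)
      = (\<Sum>i<n. \<bar>row (stack_powers B N) (k * n + i) \<bullet> x\<bar> powr p)"
      using sum.shift_bounds_nat_ivl[of "\<lambda>q. \<bar>row (stack_powers B N) q \<bullet> x\<bar> powr p" 0 "k * n" n]
      by (simp add: atLeast0LessThan add.commute)
    then show "(\<Sum>q=k * n..<k * n + n. \<bar>row (stack_powers B N) q \<bullet> x\<bar> powr p)
      = (\<Sum>i<n. \<bar>row (B ^\<^sub>m k) i \<bullet> x\<bar> powr p)"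
      using k by (simp add: row)
  qed
  finally show ?thesis
    using B by (simp add: lyap_def sum_distrib_left stack_powers_def Let_def)
qed

lemma lyap_mult_mat_vec:
  assumes "M \<in> carrier_mat m n" "B \<in> carrier_mat n k" "x \<in> carrier_vec k"
  shows "lyap M p (B *\<^sub>v x) = lyap (M * B) p x"
proof -
  have "row M i \<bullet> (B *\<^sub>v x) = row (M * B) i \<bullet> x" if "i < m" for i
    using assms assoc_mult_mat_vec[of M m n B k x] that
    by (metis carrier_matD(1) index_mult_mat(2) index_mult_mat_vec)
  then show ?thesis using assms by (simp add: lyap_def)
qed

text \<open>An Euler step shifts the summands of \<open>lyap_stack_powers\<close> by one, so the difference telescopes.\<close>

lemma lyap_stack_powers_step:
  assumes B: "B \<in> carrier_mat n n" and x: "x \<in> carrier_vec n"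
  shows "lyap (stack_powers B N) p (B *\<^sub>v x) - lyap (stack_powers B N) p x
    = lyap (B ^\<^sub>m N) p x - lyap (1\<^sub>m n) p x"
proof -
  have "lyap (B ^\<^sub>m k) p (B *\<^sub>v x) = lyap (B ^\<^sub>m Suc k) p x" for k
    using B x by (simp add: lyap_mult_mat_vec[of _ n n _ n])
  then have "lyap (stack_powers B N) p (B *\<^sub>v x) - lyap (stack_powers B N) p x
    = (\<Sum>k<N. lyap (B ^\<^sub>m Suc k) p x - lyap (B ^\<^sub>m k) p x)"
    by (simp only: lyap_stack_powers[OF B] sum_subtractf)
  also have "\<dots> = lyap (B ^\<^sub>m N) p x - lyap (B ^\<^sub>m 0) p x"
    by (rule sum_lessThan_telescope)
  finally show ?thesis using B by simp
qed

lemma lyap_smult_mat: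
  assumes x: "x \<in> carrier_vec (dim_col M)"
  shows "lyap (c \<cdot>\<^sub>m M) p x = \<bar>c\<bar> powr p * lyap M p x"
proof -
  have "row (c \<cdot>\<^sub>m M) i \<bullet> x = c * (row M i \<bullet> x)" if "i < dim_row M" for i
    using x that by (simp add: scalar_prod_def sum_distrib_left mult.assoc)
  then show ?thesis
    by (simp add: lyap_def abs_mult powr_mult sum_distrib_left mult.left_commute)
qed

section \<open>Dissipation along the solutions from an eigenvector\<close>

lemma row_inner_map_vec_Re:
  assumes "M \<in> carrier_mat m n" "v \<in> carrier_vec n" "i < m"
  shows "row M i \<bullet> map_vec Re v = Re (row (map_mat complex_of_real M) i \<bullet> v)"
  using assms by (auto simp: scalar_prod_def Re_sum intro!: sum.cong)

lemma mult_mat_map_vec_Re: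
  assumes "M \<in> carrier_mat m n" "v \<in> carrier_vec n"
  shows "M *\<^sub>v map_vec Re v = map_vec Re (map_mat complex_of_real M *\<^sub>v v)"
  using assms by (intro eq_vecI) (auto simp: row_inner_map_vec_Re[of _ m n])

lemma lyap_has_derivative_along_curve:
  assumes p: "1 < p" and M: "M \<in> carrier_mat m n"
    and y: "y t \<in> carrier_vec n" and d: "d \<in> carrier_vec n"
    and der: "\<And>i. i < m \<Longrightarrow> ((\<lambda>s. row M i \<bullet> y s) has_real_derivative row M i \<bullet> d) (at t)"
  shows "((\<lambda>s. lyap M p (y s)) has_real_derivative gradient (lyap M p) (y t) \<bullet> d) (at t)"
proof -
  have "((\<lambda>s. 1 / p * (\<Sum>i<m. \<bar>row M i \<bullet> y s\<bar> powr p)) has_real_derivative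
    1 / p * (\<Sum>i<m. p * (\<bar>row M i \<bullet> y t\<bar> powr (p - 1) * sgn (row M i \<bullet> y t)) * (row M i \<bullet> d))) (at t)"
    by (intro DERIV_cmult DERIV_sum DERIV_chain2[OF has_real_derivative_abs_powr[OF p]] der) simp
  also have "1 / p * (\<Sum>i<m. p * (\<bar>row M i \<bullet> y t\<bar> powr (p - 1) * sgn (row M i \<bullet> y t)) * (row M i \<bullet> d))
    = gradient (lyap M p) (y t) \<bullet> d"
    using p by (simp add: gradient_lyap_inner[OF p M y d] sum_distrib_left mult.assoc)
  finally show ?thesis using M by (simp add: lyap_def)
qed

text \<open>If the eigenvector is purely imaginary, multiplying it by \<open>\<i>\<close> makes it real.\<close>

lemma eigenvector_with_nonzero_Re:
  assumes A: "A \<in> carrier_mat n n" and ev: "eigenvalue A k"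
  obtains v where "v \<in> carrier_vec n" "map_vec Re v \<noteq> 0\<^sub>v n" "A *\<^sub>v v = k \<cdot>\<^sub>v v"
proof -
  obtain v where v: "v \<in> carrier_vec n" "v \<noteq> 0\<^sub>v n" "A *\<^sub>v v = k \<cdot>\<^sub>v v"
    using ev A by (auto simp: eigenvalue_def eigenvector_def)
  show thesis
  proof (cases "map_vec Re v = 0\<^sub>v n")
    case False
    then show thesis using v that by blast
  next
    case True
    have Re0: "Re (v $ i) = 0" if "i < n" for i
      using arg_cong[OF True, of "\<lambda>w. w $ i"] that v(1) by simp
    have "map_vec Re (\<i> \<cdot>\<^sub>v v) \<noteq> 0\<^sub>v n"
    proof
      assume eq: "map_vec Re (\<i> \<cdot>\<^sub>v v) = 0\<^sub>v n"
      have "Im (v $ i) = 0" if "i < n" for i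
        using arg_cong[OF eq, of "\<lambda>w. w $ i"] that v(1) by simp
      then have "v = 0\<^sub>v n"
        using Re0 v(1) by (intro eq_vecI) (auto simp: complex_eq_iff)
      then show False using v(2) by simp
    qed
    moreover have "A *\<^sub>v (\<i> \<cdot>\<^sub>v v) = k \<cdot>\<^sub>v (\<i> \<cdot>\<^sub>v v)"
      using mult_mat_vec[OF A v(1)] v(3) by (simp add: smult_smult_assoc mult.commute)
    ultimately show thesis using v(1) that[of "\<i> \<cdot>\<^sub>v v"] by simp
  qed
qed

text \<open>One full rotation of \<open>exp (k * t)\<close>; when \<open>k\<close> is real, any positive time will do.\<close>

lemma exp_period:
  fixes k :: complex
  obtains T :: real where "0 < T" "exp (k * of_real T) = of_real (exp (Re k * T))"
proof (cases "Im k = 0")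
  case True
  then have "k = of_real (Re k)" by (simp add: complex_eq_iff)
  then have "exp (k * of_real 1) = of_real (exp (Re k * 1))"
    by (metis exp_of_real mult.right_neutral of_real_1)
  then show thesis by (intro that[of 1]) simp
next
  case False
  define T where "T = 2 * pi / \<bar>Im k\<bar>"
  have "Im k * T = 2 * pi \<or> Im k * T = - (2 * pi)"
    using False by (auto simp: T_def abs_if)
  then have "cos (Im k * T) = 1" "sin (Im k * T) = 0" by auto
  then have "exp (k * of_real T) = of_real (exp (Re k * T))"
    by (simp add: complex_eq_iff Re_exp Im_exp)
  then show thesis using False by (intro that[of T]) (simp add: T_def)
qed

text \<open>If \<open>Re k \<ge> 0\<close>, the solution \<open>Re (exp (k * t) v)\<close> returns after a rotation to a multiple of its
  initial value by a factor at least \<open>1\<close>. By homogeneity \<open>lyap R p\<close> has then not dropped,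
  although it decreases strictly at time \<open>0\<close> and is never increasing.\<close>

lemma dissipation_imp_Hurwitz:
  assumes A: "A \<in> carrier_mat n n" and p: "1 < p"
    and R: "R \<in> carrier_mat r n" 
    and S: "S \<in> carrier_mat s n" "full_column_rank S"
    and diss: "\<And>x. x \<in> carrier_vec n \<Longrightarrow>
      gradient (lyap R p) x \<bullet> (A *\<^sub>v x) + lyap S p x \<le> 0"
  shows "Hurwitz A"
  unfolding Hurwitz_def
proof (intro conjI allI impI)
  show "square_mat A" using A by simp
next
  let ?C = "map_mat complex_of_real"
  fix k assume ev: "eigenvalue (?C A) k"
  show "Re k < 0"
  proof (rule ccontr)
    assume "\<not> Re k < 0"
    then have k: "0 \<le> Re k" by simp
    have CA: "?C A \<in> carrier_mat n n" using A by simp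
    obtain v where v: "v \<in> carrier_vec n" "map_vec Re v \<noteq> 0\<^sub>v n" "?C A *\<^sub>v v = k \<cdot>\<^sub>v v"
      by (rule eigenvector_with_nonzero_Re[OF CA ev])
    obtain T where T: "0 < T" "exp (k * of_real T) = of_real (exp (Re k * T))"
      by (rule exp_period)
    define y where "y t = map_vec Re (exp (k * of_real t) \<cdot>\<^sub>v v)" for t :: real
    have y: "y t \<in> carrier_vec n" for t using v by (simp add: y_def)
    have Ay: "A *\<^sub>v y t = map_vec Re ((k * exp (k * of_real t)) \<cdot>\<^sub>v v)" for t
      using v by (simp add: y_def mult_mat_map_vec_Re[OF A] mult_mat_vec[OF CA] smult_smult_assoc mult.commute)
    have der: "((\<lambda>t. lyap R p (y t)) has_real_derivative
      gradient (lyap R p) (y t) \<bullet> (A *\<^sub>v y t)) (at t)" for t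
    proof (rule lyap_has_derivative_along_curve[OF p R y])
      show "A *\<^sub>v y t \<in> carrier_vec n" by (rule mult_mat_vec_carrier[OF A y])
      fix i assume i: "i < r"
      define z where "z = row (?C R) i \<bullet> v"
      have z: "row R i \<bullet> map_vec Re (c \<cdot>\<^sub>v v) = Re (c * z)" for c
        using v i R by (simp add: z_def row_inner_map_vec_Re[OF R])
      have "((\<lambda>t. exp (k * of_real t) * z) has_vector_derivative k * exp (k * of_real t) * z) (at t)"
        by (auto intro!: derivative_eq_intros has_vector_derivative_real_field)
      then have "((\<lambda>t. Re (exp (k * of_real t) * z)) has_real_derivative Re (k * exp (k * of_real t) * z)) (at t)"
        unfolding has_real_derivative_iff_has_vector_derivative
        by (rule bounded_linear.has_vector_derivative[OF bounded_linear_Re])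
      moreover have "row R i \<bullet> y s = Re (exp (k * of_real s) * z)" for s
        by (simp only: y_def z)
      moreover have "row R i \<bullet> (A *\<^sub>v y t) = Re (k * exp (k * of_real t) * z)"
        by (simp only: Ay z)
      ultimately show "((\<lambda>s. row R i \<bullet> y s) has_real_derivative row R i \<bullet> (A *\<^sub>v y t)) (at t)"
        by simp
    qed
    have der_le: "gradient (lyap R p) (y t) \<bullet> (A *\<^sub>v y t) \<le> - lyap S p (y t)" for t
      using diss[OF y[of t]] by simp
    have y0: "y 0 = map_vec Re v" using v by (simp add: y_def)
    have "gradient (lyap R p) (y 0) \<bullet> (A *\<^sub>v y 0) < 0"
      using der_le[of 0] lyap_pos[OF p S y[of 0]] v y0 by simp
    from DERIV_neg_dec_right[OF der this]
    obtain d where d: "0 < d" "\<And>h. 0 < h \<Longrightarrow> h < d \<Longrightarrow> lyap R p (y h) < lyap R p (y 0)"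
      by auto
    define h where "h = min T (d / 2)"
    have h: "0 < h" "h < d" "h \<le> T" using T d by (auto simp: h_def)
    have "lyap R p (y T) \<le> lyap R p (y h)"
    proof (rule DERIV_nonpos_imp_nonincreasing[OF h(3)])
      fix t
      have "gradient (lyap R p) (y t) \<bullet> (A *\<^sub>v y t) \<le> 0"
        using der_le[of t] lyap_nonneg[of p S "y t"] p by simp
      then show "\<exists>l. ((\<lambda>t. lyap R p (y t)) has_real_derivative l) (at t) \<and> l \<le> 0"
        using der by blast
    qed
    also have "\<dots> < lyap R p (y 0)" using d h by simp
    also have "\<dots> \<le> exp (Re k * T) powr p * lyap R p (y 0)"
    proof -
      have "1 \<le> exp (Re k * T)" using k T by simp
      then have "1 \<le> exp (Re k * T) powr p" using p by (simp add: ge_one_powr_ge_zero)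
      then show ?thesis using lyap_nonneg[of p R "y 0"] p by (simp add: mult_le_cancel_right1)
    qed
    also have "\<dots> = lyap R p (exp (Re k * T) \<cdot>\<^sub>v y 0)"
      using lyap_smult[of "y 0" R] R y by simp
    also have "exp (Re k * T) \<cdot>\<^sub>v y 0 = y T"
      using v by (auto simp: y_def T(2))
    finally show False by simp
  qed
qed

section \<open>The dissipation inequality for a Hurwitz matrix\<close>

text \<open>The decrease of \<open>lyap R p\<close> over one Euler step yields both conclusions about \<open>R\<close>: convexity
  turns it into the dissipation inequality, and since \<open>lyap R p\<close> is nonnegative after the step,
  it must be positive before it at every nonzero point, which is full column rank.\<close>

lemma Hurwitz_imp_dissipation:
  assumes A: "A \<in> carrier_mat n n" and p: "1 < p" and H: "Hurwitz A"
  obtains r R S where "R \<in> carrier_mat r n" "full_column_rank R"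
    "S \<in> carrier_mat n n" "full_column_rank S"
    "\<And>x. x \<in> carrier_vec n \<Longrightarrow> gradient (lyap R p) x \<bullet> (A *\<^sub>v x) + lyap S p x \<le> 0"
proof -
  obtain h where h: "0 < h"
    "\<And>k. eigenvalue (map_mat complex_of_real (1\<^sub>m n + h \<cdot>\<^sub>m A)) k \<Longrightarrow> cmod k < 1"
    using Hurwitz_imp_Euler_step_contractive[OF A H] by blast
  define B where "B = 1\<^sub>m n + h \<cdot>\<^sub>m A"
  have B: "B \<in> carrier_mat n n" using A by (simp add: B_def)
  have lim: "(\<lambda>k. (B ^\<^sub>m k) $$ (i, j)) \<longlonglongrightarrow> 0" if ij: "i < n" "j < n" for i j
  proof -
    have "map_mat complex_of_real B ^\<^sub>m k = map_mat complex_of_real (B ^\<^sub>m k)" for k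
      by (rule of_real_hom.mat_hom_pow[OF B, symmetric])
    moreover have "(B ^\<^sub>m k) \<in> carrier_mat n n" for k using B by simp
    ultimately have "(map_mat complex_of_real B ^\<^sub>m k) $$ (i, j) = of_real ((B ^\<^sub>m k) $$ (i, j))" for k
      using ij by (metis carrier_matD index_map_mat(1))
    moreover have "(\<lambda>k. (map_mat complex_of_real B ^\<^sub>m k) $$ (i, j)) \<longlonglongrightarrow> 0"
      using B h ij by (intro pow_mat_tendsto_0[of _ n]) (auto simp: B_def)
    ultimately have "(\<lambda>k. complex_of_real ((B ^\<^sub>m k) $$ (i, j))) \<longlonglongrightarrow> of_real 0" by simp
    then show ?thesis by (simp only: tendsto_of_real_iff)
  qed
  obtain N where N: "\<And>x. x \<in> carrier_vec n \<Longrightarrow> lyap (B ^\<^sub>m N) p x \<le> lyap (1\<^sub>m n) p x / 2"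
    using lyap_pow_mat_contractive[OF p B lim] by blast
  define R where "R = stack_powers B N"
  have R: "R \<in> carrier_mat (N * n) n" using B by (simp add: R_def stack_powers_def Let_def)
  \<comment> \<open>The scaling turns the factor \<open>1 / (2 * h)\<close>, which is what the decrease by one half leaves after
    division by \<open>h\<close>, into \<open>lyap S p\<close>.\<close>
  define c where "c = (1 / (2 * h)) powr (1 / p)"
  have c: "0 < c" "c powr p = 1 / (2 * h)" using h p by (auto simp: c_def powr_powr)
  define S where "S = c \<cdot>\<^sub>m (1\<^sub>m n :: real mat)"
  have S: "S \<in> carrier_mat n n" by (simp add: S_def)
  have one_rank: "full_column_rank (1\<^sub>m n)"
    by (subst full_column_rank_iff_trivial_kernel[of _ n n]) auto
  have step: "lyap R p (B *\<^sub>v x) - lyap R p x \<le> - lyap (1\<^sub>m n) p x / 2" if "x \<in> carrier_vec n" for x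
    using lyap_stack_powers_step[OF B that, of N p] N[OF that] by (simp add: R_def)
  have "full_column_rank R"
    unfolding full_column_rank_iff_trivial_kernel[OF R]
  proof (intro ballI impI)
    fix x :: "real vec" assume x: "x \<in> carrier_vec n" and Rx: "R *\<^sub>v x = 0\<^sub>v (N * n)"
    have "row R i \<bullet> x = 0" if "i < N * n" for i
      using arg_cong[OF Rx, of "\<lambda>w. w $ i"] that R by simp
    then have "lyap R p x = 0" using R p by (simp add: lyap_def)
    then have "lyap (1\<^sub>m n) p x \<le> 0"
      using step[OF x] lyap_nonneg[of p R "B *\<^sub>v x"] p by simp
    then show "x = 0\<^sub>v n"
      using lyap_pos[OF p one_carrier_mat one_rank x] by force
  qed
  moreover have "full_column_rank S"
    unfolding full_column_rank_iff_trivial_kernel[OF S]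
  proof (intro ballI impI)
    fix x :: "real vec" assume x: "x \<in> carrier_vec n" and Sx: "S *\<^sub>v x = 0\<^sub>v n"
    show "x = 0\<^sub>v n"
    proof (rule eq_vecI)
      fix i assume i: "i < dim_vec (0\<^sub>v n :: real vec)"
      then have "(S *\<^sub>v x) $ i = c * x $ i"
        using x by (simp add: S_def scalar_prod_left_unit)
      then show "x $ i = 0\<^sub>v n $ i" using Sx x c i by simp
    qed (use x in simp)
  qed
  moreover have "gradient (lyap R p) x \<bullet> (A *\<^sub>v x) + lyap S p x \<le> 0" if x: "x \<in> carrier_vec n" for x
  proof -
    have Ax: "A *\<^sub>v x \<in> carrier_vec n" by (rule mult_mat_vec_carrier[OF A x])
    have g: "gradient (lyap R p) x \<in> carrier_vec n" using x by (simp add: gradient_def)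
    have Bx: "B *\<^sub>v x = x + h \<cdot>\<^sub>v (A *\<^sub>v x)"
      using A x by (auto simp: B_def add_mult_distrib_mat_vec[of _ n n])
    have "lyap R p x + gradient (lyap R p) x \<bullet> (h \<cdot>\<^sub>v (A *\<^sub>v x)) \<le> lyap R p (B *\<^sub>v x)"
      unfolding Bx using Ax by (intro lyap_above_tangent[OF p R x]) simp
    also have "gradient (lyap R p) x \<bullet> (h \<cdot>\<^sub>v (A *\<^sub>v x)) = h * (gradient (lyap R p) x \<bullet> (A *\<^sub>v x))"
      using g Ax by (rule scalar_prod_smult_distrib)
    finally have "h * (gradient (lyap R p) x \<bullet> (A *\<^sub>v x)) \<le> - lyap (1\<^sub>m n) p x / 2"
      using step[OF x] by simp
    then have "gradient (lyap R p) x \<bullet> (A *\<^sub>v x) \<le> - lyap (1\<^sub>m n) p x / (2 * h)"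
      using h by (simp add: field_simps)
    moreover have "lyap S p x = lyap (1\<^sub>m n) p x / (2 * h)"
      using x c by (simp add: S_def lyap_smult_mat)
    ultimately show ?thesis by simp
  qed
  ultimately show thesis using R S that by blast
qed

theorem mainTheorem1:
  fixes A :: "real mat" and n :: nat and p :: real
  assumes "A \<in> carrier_mat n n" and "1 < p"
  shows "Hurwitz A \<longleftrightarrow>
    (\<exists>r s R S. R \<in> carrier_mat r n \<and> full_column_rank R \<and>
               S \<in> carrier_mat s n \<and> full_column_rank S \<and>
      (\<forall>x \<in> carrier_vec n.
        gradient (lyap R p) x \<bullet> (A *\<^sub>v x) + lyap S p x \<le> 0))"
proof
  assume "Hurwitz A"
  then show "\<exists>r s R S. R \<in> carrier_mat r n \<and> full_column_rank R \<and>
               S \<in> carrier_mat s n \<and> full_column_rank S \<and>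
      (\<forall>x \<in> carrier_vec n.
        gradient (lyap R p) x \<bullet> (A *\<^sub>v x) + lyap S p x \<le> 0)"
    using Hurwitz_imp_dissipation[OF assms] by metis
next
  assume "\<exists>r s R S. R \<in> carrier_mat r n \<and> full_column_rank R \<and>
               S \<in> carrier_mat s n \<and> full_column_rank S \<and>
      (\<forall>x \<in> carrier_vec n.
        gradient (lyap R p) x \<bullet> (A *\<^sub>v x) + lyap S p x \<le> 0)"
  then show "Hurwitz A"
    using dissipation_imp_Hurwitz[OF assms] by blast
qed

end
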